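(* Consider the polynomial Prony system with two nodes $z_1=e^{\imath\xi_1}$ and $z_2=e^{\imath\xi_2}$, where $\xi_1,\xi_2\in\mathbb{R}$, $\xi_2=\xi_1+\delta$ and $0<\delta<1$, and let $x=(\{a_{\ell,j}\},\{z_j\})$ be the vector of its parameters. Fix some $0<r_0<2\pi$. Then for any integer $p\ge1$ satisfying $p\delta<r_0$, $$\rho(x,z_j,p)>\alpha(r_0)^{R}\,p^{R+\ell_j},\qquad j=1,2,$$ where $\alpha(r)=\dfrac{\sqrt{2(1-\cos r)}}{r}$.
   Context: The polynomial Prony system with two nodes is $m_k=\sum_{j=1}^{2}z_j^k\sum_{\ell=0}^{\ell_j-1}a_{\ell,j}k^\ell$, with integers $\ell_1,\ell_2\ge1$, magnitudes $a_{\ell,j}\in\mathbb{C}$ and $a_{\ell_j-1,j}\neq0$; $R=(\ell_1+1)+(\ell_2+1)$ is the number of unknowns. The improvement function is $$\rho(x,z_j,p)=\left(\frac{|z_1^p-z_2^p|}{|z_1-z_2|}\right)^{R}p^{\ell_j}.$$ *)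

theory Defs
  imports Complex_Main
begin

text \<open>
  The parameter vector of a polynomial Prony system with two nodes. Nodes are indexed by
  \<open>j \<in> {1, 2}\<close>; the magnitude \<open>a\<^bsub>\<ell>,j\<^esub>\<close> is \<open>mag x l j\<close>, for \<open>l < mult x j\<close>. Values of the
  fields at other indices carry no meaning and are never used.
\<close>

record prony_params =
  mult :: "nat \<Rightarrow> nat"
  mag :: "nat \<Rightarrow> nat \<Rightarrow> complex"
  node :: "nat \<Rightarrow> complex"

definition prony_system :: "prony_params \<Rightarrow> (nat \<Rightarrow> complex) \<Rightarrow> bool" where
  "prony_system x m \<longleftrightarrow>
     (\<forall>j\<in>{1..2}. mult x j \<ge> 1 \<and> mag x (mult x j - 1) j \<noteq> 0) \<and>
     (\<forall>k. m k = (\<Sum>j=1..2. node x j ^ k * (\<Sum>l<mult x j. mag x l j * of_nat k ^ l)))"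

definition num_unknowns :: "prony_params \<Rightarrow> nat" where
  "num_unknowns x = (mult x 1 + 1) + (mult x 2 + 1)"

text \<open>
  The improvement function \<open>\<rho>(x, z\<^sub>j, p)\<close>. The node \<open>z\<^sub>j\<close> enters only through its multiplicity,
  so it is passed by its index \<open>j\<close>.
\<close>

definition improvement :: "prony_params \<Rightarrow> nat \<Rightarrow> nat \<Rightarrow> real" where
  "improvement x j p =
     (cmod (node x 1 ^ p - node x 2 ^ p) / cmod (node x 1 - node x 2)) ^ num_unknowns x
     * real p ^ mult x j"

definition prony_alpha :: "real \<Rightarrow> real" where
  "prony_alpha r = sqrt (2 * (1 - cos r)) / r"

end

theory Submission
  imports Defs
begin

text \<open>
  Chords of the unit circle satisfy \<open>|e\<^bsup>ia\<^esup> - e\<^bsup>ib\<^esup>| = 2 |sin ((a - b) / 2)|\<close>, so the ratio in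
  \<open>\<rho>\<close> is \<open>sin (p\<delta>/2) / sin (\<delta>/2)\<close>. Since \<open>sin (\<delta>/2) \<le> \<delta>/2\<close>, it is at least
  \<open>p * (sin (p\<delta>/2) / (p\<delta>/2))\<close>, and \<open>\<alpha> r = sin (r/2) / (r/2)\<close> is strictly decreasing
  on \<open>(0, 2\<pi>)\<close>.
\<close>

lemma norm_exp_i_diff:
  "cmod (exp (\<i> * complex_of_real a) - exp (\<i> * complex_of_real b)) = sqrt (2 * (1 - cos (a - b)))"
proof -
  have "(cos a - cos b)\<^sup>2 + (sin a - sin b)\<^sup>2 = 2 * (1 - cos (a - b))"
    using sin_cos_squared_add[of a] sin_cos_squared_add[of b]
    by (simp add: cos_diff power2_eq_square algebra_simps)
  then show ?thesis
    by (simp add: cmod_def Re_exp Im_exp)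
qed

text \<open>Half-angle formula; the range puts t/2 in [0, \<pi>], where the sine is nonnegative and
  the root needs no absolute value.\<close>

lemma sqrt_two_one_minus_cos:
  assumes "0 \<le> t" and "t \<le> 2 * pi"
  shows "sqrt (2 * (1 - cos t)) = 2 * sin (t / 2)"
proof -
  have "2 * (1 - cos t) = (2 * sin (t / 2))\<^sup>2"
    using cos_double_sin[of "t / 2"] by (simp add: power_mult_distrib)
  moreover have "0 \<le> sin (t / 2)"
    using assms by (intro sin_ge_zero) auto
  ultimately show ?thesis
    by (simp only: real_sqrt_abs abs_of_nonneg mult_nonneg_nonneg zero_le_numeral)
qed

text \<open>Fixes the sign of the derivative of sin t / t. The difference sin t - t cos t vanishes
  at 0 and has derivative t sin t, positive on (0, \<pi>).\<close>

lemma x_cos_less_sin: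
  fixes x :: real
  assumes "0 < x" and "x \<le> pi"
  shows "x * cos x < sin x"
proof -
  have "(\<lambda>t::real. sin t - t * cos t) 0 < (\<lambda>t. sin t - t * cos t) x"
  proof (rule DERIV_pos_imp_increasing_open[OF assms(1)])
    fix t :: real
    assume t: "0 < t" "t < x"
    have "((\<lambda>t. sin t - t * cos t) has_real_derivative t * sin t) (at t)"
      by (auto intro!: derivative_eq_intros)
    moreover have "0 < t * sin t"
      using t assms by (intro mult_pos_pos sin_gt_zero) auto
    ultimately show "\<exists>D. ((\<lambda>t. sin t - t * cos t) has_real_derivative D) (at t) \<and> 0 < D"
      by blast
  qed (intro continuous_intros)
  then show ?thesis by simp
qed

lemma sin_over_x_strict_decreasing:
  fixes x y :: real
  assumes "0 < x" and "x < y" and "y \<le> pi"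
  shows "sin y / y < sin x / x"
proof (rule DERIV_neg_imp_decreasing_open[OF assms(2)])
  fix t :: real
  assume t: "x < t" "t < y"
  have "((\<lambda>t. sin t / t) has_real_derivative (cos t * t - sin t) / (t * t)) (at t)"
    using t assms by (auto intro!: derivative_eq_intros)
  moreover have "(cos t * t - sin t) / (t * t) < 0"
    using x_cos_less_sin[of t] t assms by (intro divide_neg_pos) (auto simp: mult.commute)
  ultimately show "\<exists>D. ((\<lambda>t. sin t / t) has_real_derivative D) (at t) \<and> D < 0"
    by blast
next
  show "continuous_on {x..y} (\<lambda>t. sin t / t)"
    using assms by (intro continuous_intros) auto
qed

lemma prony_alpha_eq_sinc:
  assumes "0 < r" and "r \<le> 2 * pi"
  shows "prony_alpha r = sin (r / 2) / (r / 2)"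
  using assms sqrt_two_one_minus_cos[of r] by (simp add: prony_alpha_def)

lemma prony_alpha_strict_decreasing:
  assumes "0 < s" and "s < r" and "r \<le> 2 * pi"
  shows "prony_alpha r < prony_alpha s"
  using assms sin_over_x_strict_decreasing[of "s / 2" "r / 2"] by (simp add: prony_alpha_eq_sinc)

lemma prony_alpha_nonneg:
  assumes "0 < r"
  shows "0 \<le> prony_alpha r"
  using assms by (simp add: prony_alpha_def)

theorem corollary2p17:
  fixes x :: prony_params and m :: "nat \<Rightarrow> complex"
    and \<xi>\<^sub>1 \<xi>\<^sub>2 \<delta> r\<^sub>0 :: real and p j :: nat
  assumes "prony_system x m"
    and "node x 1 = exp (\<i> * complex_of_real \<xi>\<^sub>1)"
    and "node x 2 = exp (\<i> * complex_of_real \<xi>\<^sub>2)"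
    and "\<xi>\<^sub>2 = \<xi>\<^sub>1 + \<delta>" and "0 < \<delta>" and "\<delta> < 1"
    and "0 < r\<^sub>0" and "r\<^sub>0 < 2 * pi"
    and "p \<ge> 1" and "real p * \<delta> < r\<^sub>0"
    and "j \<in> {1, 2}"
  shows "improvement x j p
           > prony_alpha r\<^sub>0 ^ num_unknowns x * real p ^ (num_unknowns x + mult x j)"
proof -
  let ?q = "cmod (node x 1 ^ p - node x 2 ^ p) / cmod (node x 1 - node x 2)"
  have p: "0 < real p" using assms by simp
  \<comment> \<open>One formula serves both chords of the ratio, with t = p\<delta> above and t =
    \<delta> below.\<close>
  have chord: "cmod (exp (\<i> * complex_of_real a) - exp (\<i> * complex_of_real (a + t)))
      = t * prony_alpha t" if "0 < t" for a t
    using that by (simp add: norm_exp_i_diff prony_alpha_def del: of_real_add)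
  have pow: "exp (\<i> * complex_of_real a) ^ p = exp (\<i> * complex_of_real (real p * a))" for a
    by (simp add: exp_of_nat_mult[symmetric] mult.left_commute)
  have num: "cmod (node x 1 ^ p - node x 2 ^ p) = real p * \<delta> * prony_alpha (real p * \<delta>)"
    using chord[of "real p * \<delta>" "real p * \<xi>\<^sub>1"] assms(2-5) p
    by (simp add: pow distrib_left del: of_real_add of_real_mult)
  have den: "cmod (node x 1 - node x 2) = \<delta> * prony_alpha \<delta>"
    using chord[of \<delta> \<xi>\<^sub>1] assms(2-5) by simp
  have "\<delta> < 2 * pi" using assms(6) pi_ge_two by linarith
  \<comment> \<open>Strict decrease up to 2\<pi>, where the value is still nonnegative, forces
    positivity at \<delta>.\<close>
  then have "0 < prony_alpha \<delta>"
    using prony_alpha_strict_decreasing[of \<delta> "2 * pi"] prony_alpha_nonneg[of "2 * pi"] assms(5)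
    by simp
  moreover have "prony_alpha \<delta> \<le> 1"
    using sin_x_le_x[of "\<delta> / 2"] assms(5) \<open>\<delta> < 2 * pi\<close> by (simp add: prony_alpha_eq_sinc)
  \<comment> \<open>Dividing a nonnegative number by \<open>prony_alpha \<delta>\<close>, which lies
    in (0, 1], cannot decrease it.\<close>
  ultimately have "real p * prony_alpha (real p * \<delta>)
      \<le> real p * prony_alpha (real p * \<delta>) / prony_alpha \<delta>"
    using assms(5) p prony_alpha_nonneg[of "real p * \<delta>"]
    by (simp add: pos_le_divide_eq mult_left_le)
  also have "\<dots> = ?q"
    unfolding num den using assms(5) by simp
  finally have "real p * prony_alpha (real p * \<delta>) \<le> ?q" .
  moreover have "prony_alpha r\<^sub>0 < prony_alpha (real p * \<delta>)"
    using assms p by (intro prony_alpha_strict_decreasing) auto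
  ultimately have "real p * prony_alpha r\<^sub>0 < ?q"
    using p by (meson less_le_trans mult_strict_left_mono)
  \<comment> \<open>Strictness survives the power because the smaller base is nonnegative and the
    exponent is positive.\<close>
  then have "(real p * prony_alpha r\<^sub>0) ^ num_unknowns x < ?q ^ num_unknowns x"
    using prony_alpha_nonneg[OF assms(7)]
    by (intro power_strict_mono) (auto simp: num_unknowns_def)
  then have "(real p * prony_alpha r\<^sub>0) ^ num_unknowns x * real p ^ mult x j
      < ?q ^ num_unknowns x * real p ^ mult x j"
    using p by (intro mult_strict_right_mono) auto
  then show ?thesis
    by (simp add: improvement_def power_mult_distrib power_add mult_ac)
qed

end
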